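(* Let $n,r,k$ be non-negative integers with $n\ge 3$ and $r+1\le k\le n-1$. Fix a linear subspace $L_0\in G(n,r)$ and $m\in\{0,\ldots,r+1\}$. Then there is no function $\varphi$ satisfying $$\int_{G(L_0,k)} \varphi(K\cap L)\,\nu_k^{L_0}(dL)=V_{m}(K)$$ for all $K\in\mathcal K^n$, where $\mathcal K^n$ is the family of convex bodies, that is, of nonempty compact convex subsets of $\mathbb R^n$.
   Context: $G(n,k)$ is the set of $k$-dimensional linear subspaces of $\mathbb R^n$. For $L_0\in G(n,r)$ and $k>r$, $G(L_0,k)=\{L\in G(n,k): L_0\subseteq L\}$, and $\nu_k^{L_0}$ is the unique probability measure on $G(L_0,k)$ that is invariant under all rotations fixing $L_0$. The function $\varphi$ is real-valued and is evaluated at the sections $K\cap L$, which are compact convex sets (possibly empty, even though $K$ is nonempty). The intrinsic volumes $V_0,\ldots,V_n$ of $K\in\mathcal K^n$ are given by Steiner's formula $\mathcal H^n(K+\varepsilon B^n)=\sum_{i=0}^n \varepsilon^{n-i}\kappa_{n-i}V_i(K)$, $\varepsilon\ge 0$, where $B^n$ is the Euclidean unit ball, $\mathcal H^n$ is $n$-dimensional Hausdorff (Lebesgue) measure and $\kappa_i$ is the volume of the unit ball in $\mathbb R^i$.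
   Formalization: For m = 0 the formal theorem additionally requires φ(∅) = 0: without this, the constant function φ = 1 satisfies the identity, since V_0(K) = 1 for every convex body. For m ≥ 1 the value φ(∅) is unrestricted. *)

theory Defs
  imports "HOL-Probability.Probability"
begin

definition convex_bodies :: "(real ^ 'n) set set" where
  "convex_bodies = {K. compact K \<and> convex K \<and> K \<noteq> {}}"

definition grassmannian :: "nat \<Rightarrow> (real ^ 'n) set set" where
  "grassmannian k = {L. subspace L \<and> dim L = k}"

definition subspaces_containing :: "(real ^ 'n) set \<Rightarrow> nat \<Rightarrow> (real ^ 'n) set set" where
  "subspaces_containing L0 k = {L \<in> grassmannian k. L0 \<subseteq> L}"

text \<open>The usual topology of the Grassmannian is the one obtained by identifying a subspace \<open>L\<close>
  with the orthogonal projection onto \<open>L\<close>, which is \<^term>\<open>closest_point L\<close>.  The following is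
  the resulting Borel sigma-algebra on the subspaces of dimension \<open>k\<close> containing \<open>L0\<close>,
  as a measure space carrying the zero measure.\<close>

definition borel_subspaces_containing :: "(real ^ 'n) set \<Rightarrow> nat \<Rightarrow> (real ^ 'n) set measure" where
  "borel_subspaces_containing L0 k =
     vimage_algebra (subspaces_containing L0 k)
       (\<lambda>L. matrix (closest_point L) :: real ^ 'n ^ 'n) borel"

text \<open>The invariant probability measure is unique, so it is given here by its characterizing
  property.  Rotations fix \<open>L0\<close> pointwise; requiring invariance under the larger group of
  rotations mapping \<open>L0\<close> onto itself would single out the same measure when
  \<open>dim L0 < k < CARD('n)\<close>.\<close>

definition invariant_prob :: "(real ^ 'n) set \<Rightarrow> nat \<Rightarrow> (real ^ 'n) set measure \<Rightarrow> bool" where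
  "invariant_prob L0 k \<nu> \<longleftrightarrow>
     prob_space \<nu> \<and>
     space \<nu> = subspaces_containing L0 k \<and>
     sets \<nu> = sets (borel_subspaces_containing L0 k) \<and>
     (\<forall>Q :: real ^ 'n ^ 'n. rotation_matrix Q \<and> (\<forall>x\<in>L0. Q *v x = x) \<longrightarrow>
        distr \<nu> \<nu> (\<lambda>L. (\<lambda>x. Q *v x) ` L) = \<nu>)"

text \<open>The coefficients in Steiner's formula are unique; indices beyond the dimension are set to 0.
  At \<open>\<epsilon> = 0\<close> the convention \<open>0 ^ 0 = 1\<close> makes the last coefficient the volume of \<open>K\<close>.\<close>

definition intrinsic_volumes :: "(real ^ 'n) set \<Rightarrow> nat \<Rightarrow> real" where
  "intrinsic_volumes K =
     (THE V. (\<forall>i > CARD('n). V i = 0) \<and>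
       (\<forall>\<epsilon>\<ge>0. measure lebesgue (K + (\<lambda>x. \<epsilon> *\<^sub>R x) ` cball 0 1) =
          (\<Sum>i\<le>CARD('n). \<epsilon> ^ (CARD('n) - i) * unit_ball_vol (real (CARD('n) - i)) * V i)))"

abbreviation intrinsic_volume :: "nat \<Rightarrow> (real ^ 'n) set \<Rightarrow> real" where
  "intrinsic_volume m K \<equiv> intrinsic_volumes K m"

text \<open>Since \<open>V_0(K) = 1\<close> for every convex body, a constant function integrates to \<open>V_0\<close>.
  For \<open>m = 0\<close> the nonexistence claim therefore needs the usual convention that a functional
  on convex sets vanishes on the empty set; for \<open>m > 0\<close> the value on the empty set is left free.\<close>

end

theory Submission
  imports Defs
begin

text \<open>
  The value of \<open>\<phi>\<close> on a body \<open>C\<close> is forced to be \<open>V_m(K)\<close> for every body \<open>K\<close> with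
  \<open>K \<inter> L = C\<close> for almost every \<open>L\<close>: the integrand is then almost everywhere constant. So it
  suffices to exhibit two bodies that have the same almost sure section but different values of \<open>V_m\<close>.

  A generic subspace meets a body of dimension at most \<open>r + 1\<close> no better than \<open>L0\<close> does. Pick a unit
  vector \<open>g\<close> orthogonal to \<open>L0\<close> that lies in almost no \<open>L\<close>. If \<open>K\<close> spans at most \<open>L0\<close> and
  \<open>g\<close>, a point of \<open>K \<inter> L\<close> differs from a multiple of \<open>g\<close> by an element of \<open>L0 \<subseteq> L\<close>, so the
  multiple lies in \<open>L\<close>, is zero, and \<open>K \<inter> L = K \<inter> L0\<close>. For \<open>m \<ge> 1\<close> take a unit cube \<open>Q \<subseteq> L0\<close> of dimension
  \<open>m - 1\<close>, which is possible because \<open>m - 1 \<le> r\<close>, and the cube \<open>Q'\<close> of dimension \<open>m\<close> that has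
  \<open>g\<close> as additional edge. Both have almost sure section \<open>Q\<close>, but \<open>V_m(Q) = 0\<close> and
  \<open>V_m(Q') = 1\<close>. For \<open>m = 0\<close> the point \<open>g\<close> itself is almost surely missed, so
  \<open>\<phi> {} = V_0({g}) = 1\<close>, against \<open>\<phi> {} = 0\<close>.

  The vector \<open>g\<close> is found with Fubini's theorem (\<open>ex_unit_normal_AE_not_mem\<close>): a proper subspace
  \<open>L\<close> is Lebesgue null, so almost every point of the space lies in almost no \<open>L\<close>.

  The intrinsic volumes of a unit cube are binomial coefficients
  (\<open>intrinsic_volumes_orthonormal_cube\<close>). The volume of the parallel body of a cube follows from an
  induction over the edges: adding the edge \<open>j\<close> adds, on each line parallel to \<open>j\<close>, a segment of
  length one to the fibre of the parallel body, so the increase in volume is the volume of the parallel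
  body in the space without the coordinate \<open>j\<close> (\<open>emeasure_parallel_cube_insert\<close>). The cubes needed
  above are not aligned with the coordinate axes, so Lebesgue measure has to be invariant under
  orthogonal maps (\<open>emeasure_lborel_orthogonal_image\<close>); this follows from the uniqueness of
  translation-invariant measures.
\<close>

section \<open>Invariance of Lebesgue measure under orthogonal maps\<close>

text \<open>
  The standard uniqueness argument for Haar measures: by Fubini's theorem and both translation
  invariances, the substitution \<open>(x, y) \<mapsto> (x, x + y)\<close> followed by \<open>(x, y) \<mapsto> (x - y, y)\<close>
  turns \<open>\<lambda>(A) \<mu>(B)\<close>, with \<open>\<lambda>\<close> for Lebesgue measure, into \<open>\<mu>(- A) \<lambda>(B)\<close>. Taking for
  \<open>A\<close> the unit ball, which is symmetric and has the same finite positive measure for both, gives \<open>\<mu>(B) = \<lambda>(B)\<close>.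
\<close>

lemma translation_invariant_eq_lborel:
  fixes \<mu> :: "'a::euclidean_space measure"
  assumes sf: "sigma_finite_measure \<mu>"
    and sets: "sets \<mu> = sets borel"
    and trans: "\<And>a. distr \<mu> borel (\<lambda>y. a + y) = \<mu>"
    and ball: "emeasure \<mu> (cball 0 1) = emeasure lborel (cball (0::'a) 1)"
  shows "\<mu> = lborel"
proof (rule measure_eqI)
  show "sets \<mu> = sets lborel" by (simp add: sets)
  fix B assume "B \<in> sets \<mu>"
  then have B [measurable]: "B \<in> sets borel" by (simp add: sets)
  interpret M: sigma_finite_measure \<mu> by fact
  interpret P: pair_sigma_finite lborel \<mu> by standard
  note [measurable_cong] = sets
  define A where "A = cball (0::'a) 1"
  have A [measurable]: "A \<in> sets borel" by (simp add: A_def)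
  have "emeasure lborel A * emeasure \<mu> B =
      (\<integral>\<^sup>+x. \<integral>\<^sup>+y. indicator A x * indicator B y \<partial>\<mu> \<partial>lborel)"
    by (simp add: nn_integral_cmult nn_integral_multc sets)
  also have "\<dots> = (\<integral>\<^sup>+x. \<integral>\<^sup>+y. indicator A x * indicator B (x + y) \<partial>\<mu> \<partial>lborel)"
  proof (rule nn_integral_cong)
    fix x :: 'a
    show "(\<integral>\<^sup>+y. indicator A x * indicator B y \<partial>\<mu>) = (\<integral>\<^sup>+y. indicator A x * indicator B (x + y) \<partial>\<mu>)"
      by (subst trans[of x, symmetric], subst nn_integral_distr) simp_all
  qed
  also have "\<dots> = (\<integral>\<^sup>+y. \<integral>\<^sup>+x. indicator A x * indicator B (x + y) \<partial>lborel \<partial>\<mu>)"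
    by (rule P.Fubini'[symmetric]) simp
  also have "\<dots> = (\<integral>\<^sup>+y. \<integral>\<^sup>+x. indicator A (x - y) * indicator B x \<partial>lborel \<partial>\<mu>)"
  proof (rule nn_integral_cong)
    fix y :: 'a
    show "(\<integral>\<^sup>+x. indicator A x * indicator B (x + y) \<partial>lborel) =
        (\<integral>\<^sup>+x. indicator A (x - y) * indicator B x \<partial>lborel)"
      by (subst lborel_distr_plus[of "-y", symmetric], subst nn_integral_distr) (simp_all add: algebra_simps)
  qed
  also have "\<dots> = (\<integral>\<^sup>+x. \<integral>\<^sup>+y. indicator A (x - y) * indicator B x \<partial>\<mu> \<partial>lborel)"
    by (rule P.Fubini') simp
  also have "\<dots> = (\<integral>\<^sup>+x. emeasure \<mu> A * indicator B x \<partial>lborel)"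
  proof (rule nn_integral_cong)
    fix x :: 'a
    have "(\<integral>\<^sup>+y. indicator A (x - y) * indicator B x \<partial>\<mu>) =
        (\<integral>\<^sup>+y. indicator A (- y) * indicator B x \<partial>\<mu>)"
      by (subst trans[of x, symmetric], subst nn_integral_distr) simp_all
    also have "\<dots> = emeasure \<mu> A * indicator B x"
      by (simp add: A_def indicator_def nn_integral_multc sets flip: nn_integral_indicator)
    finally show "(\<integral>\<^sup>+y. indicator A (x - y) * indicator B x \<partial>\<mu>) = emeasure \<mu> A * indicator B x" .
  qed
  also have "\<dots> = emeasure lborel A * emeasure lborel B"
    by (simp add: nn_integral_cmult ball A_def)
  finally show "emeasure \<mu> B = emeasure lborel B"
    using unit_ball_vol_pos[of "real DIM('a)"]
    by (auto simp: ennreal_mult_cancel_left A_def emeasure_cball simp del: unit_ball_vol_pos)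
qed

text \<open>
  The push-forward of Lebesgue measure under \<open>f\<close> is translation invariant since \<open>f\<close> is additive and
  surjective, and it gives the unit ball its usual measure since \<open>f\<close> preserves the norm.
\<close>

lemma emeasure_lborel_orthogonal_image:
  fixes f :: "'a::euclidean_space \<Rightarrow> 'a"
  assumes f: "orthogonal_transformation f" and S: "compact S"
  shows "emeasure lborel (f ` S) = emeasure lborel S"
proof -
  have lin: "linear f" using f by (rule orthogonal_transformation_linear)
  have cont: "continuous_on X f" for X using lin by (rule linear_continuous_on_compose[OF continuous_on_id, simplified])
  have [measurable]: "f \<in> borel_measurable borel" by (rule borel_measurable_continuous_onI[OF cont])
  have meas: "f ` S \<in> sets borel"
    using compact_continuous_image[OF cont S] by (simp add: borel_compact)
  have bij: "bij f" using f by (rule orthogonal_transformation_bij)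
  have "distr lborel borel f = lborel"
  proof (rule translation_invariant_eq_lborel)
    show ball: "emeasure (distr lborel borel f) (cball 0 1) = emeasure lborel (cball (0::'a) 1)"
    proof -
      have "f -` cball 0 1 = cball 0 1"
        using f by (auto simp: orthogonal_transformation_norm)
      then show ?thesis by (simp add: emeasure_distr)
    qed
    show "distr (distr lborel borel f) borel (\<lambda>y. a + y) = distr lborel borel f" for a
    proof -
      obtain b where b: "a = f b" using bij by (meson bij_pointE)
      have "distr (distr lborel borel f) borel (\<lambda>y. a + y) = distr lborel borel (\<lambda>y. f (b + y))"
        by (simp add: distr_distr b comp_def linear_add[OF lin])
      also have "\<dots> = distr (distr lborel borel (\<lambda>y. b + y)) borel f"
        by (simp add: distr_distr comp_def)
      finally show ?thesis by (simp add: lborel_distr_plus)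
    qed
    show "sigma_finite_measure (distr lborel borel f)"
    \<comment> \<open>Pushing forward once more by the inverse map recovers the sigma-finite Lebesgue measure.\<close>
    proof (rule sigma_finite_measure_distr)
      have inv: "orthogonal_transformation (inv f)"
        using f by (rule orthogonal_transformation_inv)
      show [measurable]: "inv f \<in> borel_measurable (distr lborel borel f)"
        using linear_continuous_on[OF linear_conv_bounded_linear[THEN iffD1, OF orthogonal_transformation_linear[OF inv]]]
        by (simp add: borel_measurable_continuous_onI)
      have "distr (distr lborel borel f) borel (inv f) = distr lborel borel (\<lambda>x. x)"
        using bij by (subst distr_distr) (simp_all add: comp_def bij_is_inj)
      then show "sigma_finite_measure (distr (distr lborel borel f) borel (inv f))"
        by (simp add: sigma_finite_lborel distr_id2)
    qed
  qed simp
  moreover have "emeasure (distr lborel borel f) (f ` S) = emeasure lborel (f -` (f ` S))"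
    using meas by (simp add: emeasure_distr)
  ultimately have "emeasure lborel (f ` S) = emeasure lborel (f -` (f ` S))"
    by (rule subst)
  then show ?thesis
    by (simp add: inj_vimage_image_eq bij_is_inj[OF bij])
qed


section \<open>Volume of the parallel body of a cube\<close>

text \<open>
  Pascal's rule in the form in which it combines the Steiner polynomials of two cubes with \<open>p\<close>
  edges, one in codimension one, into that of a cube with \<open>p + 1\<close> edges.
\<close>

lemma sum_binomial_Suc:
  fixes h :: "nat \<Rightarrow> real"
  shows "(\<Sum>i\<le>Suc p. real (Suc p choose i) * h i) =
    (\<Sum>i\<le>p. real (p choose i) * h i) + (\<Sum>i\<le>p. real (p choose i) * h (Suc i))"
proof -
  have "(\<Sum>i\<le>Suc p. real (Suc p choose i) * h i) = h 0 + (\<Sum>i\<le>p. real (Suc p choose Suc i) * h (Suc i))"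
    by (subst sum.atMost_Suc_shift) simp
  also have "\<dots> = h 0 + (\<Sum>i\<le>p. real (p choose Suc i) * h (Suc i)) + (\<Sum>i\<le>p. real (p choose i) * h (Suc i))"
    by (simp add: algebra_simps sum.distrib)
  also have "h 0 + (\<Sum>i\<le>p. real (p choose Suc i) * h (Suc i)) = (\<Sum>i\<le>Suc p. real (p choose i) * h i)"
    by (subst sum.atMost_Suc_shift) simp
  also have "\<dots> = (\<Sum>i\<le>p. real (p choose i) * h i)"
    by simp
  finally show ?thesis .
qed

text \<open>
  The signed distance of a real number to the unit interval. By Pythagoras, the squared distance of a
  point to a cube is the sum of its squared overshoots in the directions of the edges and its squared
  coordinates in the remaining directions.
\<close>

definition overshoot :: "real \<Rightarrow> real" where
  "overshoot t = t - max 0 (min 1 t)"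

lemma borel_measurable_overshoot [measurable]: "overshoot \<in> borel_measurable borel"
  unfolding overshoot_def by measurable

lemma abs_overshoot_le: "0 \<le> s \<Longrightarrow> s \<le> 1 \<Longrightarrow> \<bar>overshoot t\<bar> \<le> \<bar>t - s\<bar>"
  unfolding overshoot_def by linarith

lemma overshoot_sqr_le_iff:
  assumes "0 \<le> c"
  shows "(overshoot t)\<^sup>2 \<le> c \<longleftrightarrow> t \<in> {- sqrt c .. 1 + sqrt c}"
proof -
  have "(overshoot t)\<^sup>2 \<le> c \<longleftrightarrow> \<bar>overshoot t\<bar> \<le> sqrt c"
    using real_sqrt_le_iff[of "(overshoot t)\<^sup>2" c] by simp
  also have "\<dots> \<longleftrightarrow> t \<in> {- sqrt c .. 1 + sqrt c}"
    using real_sqrt_ge_zero[OF assms] unfolding overshoot_def max_def min_def atLeastAtMost_iff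
    by (smt (verit))
  finally show ?thesis .
qed

text \<open>
  For \<open>s \<le> c\<close> the first set is the second, an interval around \<open>0\<close>, cut at \<open>0\<close> and with a unit
  segment inserted; for \<open>s > c\<close> both are empty.
\<close>

lemma emeasure_overshoot_sublevel:
  "emeasure lborel {y. s + (overshoot y)\<^sup>2 \<le> c} =
     emeasure lborel {y. s + y\<^sup>2 \<le> c} + (if s \<le> c then 1 else 0)"
proof (cases "s \<le> c")
  case True
  then have c: "0 \<le> c - s" by simp
  have "{y. s + (overshoot y)\<^sup>2 \<le> c} = {- sqrt (c - s) .. 1 + sqrt (c - s)}"
  proof -
    have "s + (overshoot y)\<^sup>2 \<le> c \<longleftrightarrow> (overshoot y)\<^sup>2 \<le> c - s" for y by linarith
    then show ?thesis unfolding overshoot_sqr_le_iff[OF c] by blast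
  qed
  moreover have "{y. s + y\<^sup>2 \<le> c} = {- sqrt (c - s) .. sqrt (c - s)}"
  proof -
    have "s + y\<^sup>2 \<le> c \<longleftrightarrow> \<bar>y\<bar> \<le> sqrt (c - s)" for y
    proof -
      have "s + y\<^sup>2 \<le> c \<longleftrightarrow> y\<^sup>2 \<le> c - s" by linarith
      then show ?thesis using real_sqrt_le_iff[of "y\<^sup>2" "c - s"] by simp
    qed
    then show ?thesis
      by (intro set_eqI) (simp only: mem_Collect_eq atLeastAtMost_iff, linarith)
  qed
  moreover have "ennreal (1 + sqrt (c - s) - - sqrt (c - s)) = ennreal (sqrt (c - s) - - sqrt (c - s)) + 1"
  proof -
    have "1 + sqrt (c - s) - - sqrt (c - s) = (sqrt (c - s) - - sqrt (c - s)) + 1"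
      by simp
    then show ?thesis
      using real_sqrt_ge_zero[OF c] by (simp only: ennreal_plus ennreal_1)
  qed
  ultimately show ?thesis
    using real_sqrt_ge_zero[OF c] True by (simp only: emeasure_lborel_Icc if_True)
next
  case False
  then have "\<not> s + u\<^sup>2 \<le> c" for u :: real
    using zero_le_power2[of u] by linarith
  with False show ?thesis by simp
qed

abbreviation lborel_on :: "'i set \<Rightarrow> ('i \<Rightarrow> real) measure" where
  "lborel_on D \<equiv> Pi\<^sub>M D (\<lambda>_. lborel)"

text \<open>
  The \<open>\<epsilon>\<close>-neighbourhood of the cube \<open>{0..1}^J \<times> {0}^(D - J)\<close> in the coordinate space \<open>\<real>^D\<close>.
  The index set \<open>D\<close> is a set, not a type, because the induction on the number of edges removes
  coordinates.
\<close>

definition parallel_cube :: "'i set \<Rightarrow> 'i set \<Rightarrow> real \<Rightarrow> ('i \<Rightarrow> real) set" where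
  "parallel_cube D J \<epsilon> = {x \<in> space (lborel_on D).
     (\<Sum>i\<in>D. (if i \<in> J then overshoot (x i) else x i)\<^sup>2) \<le> \<epsilon>\<^sup>2}"

lemma sets_parallel_cube [measurable]:
  "finite D \<Longrightarrow> parallel_cube D J \<epsilon> \<in> sets (lborel_on D)"
  unfolding parallel_cube_def by measurable

text \<open>
  Without edges the cube is a point and the neighbourhood is a ball. The radius \<open>0\<close> is separate: the
  neighbourhood is then a single point, of measure \<open>0\<close> unless \<open>D\<close> is empty, in agreement with
  \<open>0 ^ 0 = 1\<close>.
\<close>

lemma emeasure_parallel_cube_empty:
  fixes D :: "'i set"
  assumes D: "finite D" and "0 \<le> \<epsilon>"
  shows "emeasure (lborel_on D) (parallel_cube D {} \<epsilon>) =
    ennreal (unit_ball_vol (real (card D)) * \<epsilon> ^ card D)"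
proof (cases "\<epsilon> = 0")
  case False
  then have "\<epsilon> > 0" using assms by simp
  have "parallel_cube D {} \<epsilon> = {f. sqrt (\<Sum>i\<in>D. (f i)\<^sup>2) \<le> \<epsilon>} \<inter> space (lborel_on D)"
    using \<open>\<epsilon> > 0\<close> by (auto simp: parallel_cube_def real_sqrt_le_iff' sum_nonneg)
  then show ?thesis
    using emeasure_cball_aux[OF D \<open>\<epsilon> > 0\<close>] by simp
next
  case True
  interpret product_sigma_finite "\<lambda>_::'i. lborel :: real measure"
    by (simp add: product_sigma_finite_def sigma_finite_lborel)
  have "parallel_cube D {} \<epsilon> = Pi\<^sub>E D (\<lambda>_. {0})"
  proof -
    have "(\<Sum>i\<in>D. (x i)\<^sup>2) \<le> 0 \<longleftrightarrow> (\<forall>i\<in>D. x i = 0)" for x :: "'i \<Rightarrow> real"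
    proof -
      have "(\<Sum>i\<in>D. (x i)\<^sup>2) \<le> 0 \<longleftrightarrow> (\<Sum>i\<in>D. (x i)\<^sup>2) = 0"
        using sum_nonneg[of D "\<lambda>i. (x i)\<^sup>2"] by fastforce
      then show ?thesis
        using D by (simp add: sum_nonneg_eq_0_iff)
    qed
    then show ?thesis
      using True by (intro set_eqI) (auto simp: parallel_cube_def space_PiM PiE_iff fun_eq_iff extensional_def)
  qed
  then have "emeasure (lborel_on D) (parallel_cube D {} \<epsilon>) = (\<Prod>i\<in>D. emeasure (lborel :: real measure) {0})"
    using emeasure_PiM[OF D, of "\<lambda>_. {0}"] by simp
  also have "\<dots> = 0 ^ card D"
    by simp
  also have "\<dots> = ennreal (unit_ball_vol (real (card D)) * \<epsilon> ^ card D)"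
    unfolding True by (cases "card D") (simp_all add: unit_ball_vol_def)
  finally show ?thesis .
qed

text \<open>
  Slice along the lines in direction \<open>j\<close>. Making \<open>j\<close> an edge lengthens every nonempty fibre by
  exactly one, and the fibre over \<open>x\<close> is nonempty precisely when \<open>x\<close> lies in the neighbourhood of the
  cube in the space without the coordinate \<open>j\<close>.
\<close>

lemma emeasure_parallel_cube_insert:
  fixes D :: "'i set"
  assumes D: "finite D" "j \<notin> D" and j: "j \<notin> J"
  shows "emeasure (lborel_on (insert j D)) (parallel_cube (insert j D) (insert j J) \<epsilon>) =
    emeasure (lborel_on (insert j D)) (parallel_cube (insert j D) J \<epsilon>) +
    emeasure (lborel_on D) (parallel_cube D J \<epsilon>)"
proof -
  interpret product_sigma_finite "\<lambda>_::'i. lborel :: real measure"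
    by (simp add: product_sigma_finite_def sigma_finite_lborel)
  define T where "T x = (\<Sum>i\<in>D. (if i \<in> J then overshoot (x i) else x i)\<^sup>2)" for x
  have upd: "(\<Sum>i\<in>D. (if i \<in> X then overshoot ((x(j := y)) i) else (x(j := y)) i)\<^sup>2) = T x"
    if "X = J \<or> X = insert j J" for x :: "'i \<Rightarrow> real" and y X
  proof -
    have "i \<noteq> j" "i \<in> X \<longleftrightarrow> i \<in> J" if "i \<in> D" for i
      using \<open>i \<in> D\<close> \<open>j \<notin> D\<close> \<open>X = J \<or> X = insert j J\<close> by blast+
    then show ?thesis
      unfolding T_def by (intro sum.cong refl) simp
  qed
  have slice: "emeasure (lborel_on (insert j D)) A =
      (\<integral>\<^sup>+x. \<integral>\<^sup>+y. indicator A (x(j := y)) \<partial>lborel \<partial>lborel_on D)"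
    if "A \<in> sets (lborel_on (insert j D))" for A
    using product_nn_integral_insert[OF D, of "indicator A"] that by simp
  have cube: "(\<integral>\<^sup>+y. indicator (parallel_cube (insert j D) (insert j J) \<epsilon>) (x(j := y)) \<partial>lborel) =
      emeasure lborel {y. T x + (overshoot y)\<^sup>2 \<le> \<epsilon>\<^sup>2}" (is "?a = _")
    and smaller: "(\<integral>\<^sup>+y. indicator (parallel_cube (insert j D) J \<epsilon>) (x(j := y)) \<partial>lborel) =
      emeasure lborel {y. T x + y\<^sup>2 \<le> \<epsilon>\<^sup>2}" (is "?b = _")
    if x: "x \<in> space (lborel_on D)" for x
  proof -
    have sp: "x(j := y) \<in> space (lborel_on (insert j D))" for y
      using x by (auto simp: space_PiM PiE_iff extensional_def)
    have "?a = (\<integral>\<^sup>+y. indicator {y. T x + (overshoot y)\<^sup>2 \<le> \<epsilon>\<^sup>2} y \<partial>lborel)"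
      using D sp by (intro nn_integral_cong)
        (simp add: parallel_cube_def upd indicator_def add.commute del: fun_upd_apply insert_iff, simp add: add.commute)
    then show "?a = emeasure lborel {y. T x + (overshoot y)\<^sup>2 \<le> \<epsilon>\<^sup>2}" by simp
    have "?b = (\<integral>\<^sup>+y. indicator {y. T x + y\<^sup>2 \<le> \<epsilon>\<^sup>2} y \<partial>lborel)"
      using D j sp by (intro nn_integral_cong)
        (simp add: parallel_cube_def upd indicator_def add.commute del: fun_upd_apply, simp add: add.commute)
    then show "?b = emeasure lborel {y. T x + y\<^sup>2 \<le> \<epsilon>\<^sup>2}" by simp
  qed
  have T_meas [measurable]: "T \<in> borel_measurable (lborel_on D)"
    unfolding T_def by measurable
  have "emeasure (lborel_on (insert j D)) (parallel_cube (insert j D) (insert j J) \<epsilon>) =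
      (\<integral>\<^sup>+x. emeasure lborel {y. T x + (overshoot y)\<^sup>2 \<le> \<epsilon>\<^sup>2} \<partial>lborel_on D)"
    using D by (subst slice) (auto intro!: nn_integral_cong simp: cube)
  also have "\<dots> = (\<integral>\<^sup>+x. emeasure lborel {y. T x + y\<^sup>2 \<le> \<epsilon>\<^sup>2} + indicator (parallel_cube D J \<epsilon>) x \<partial>lborel_on D)"
    by (intro nn_integral_cong) (simp add: emeasure_overshoot_sublevel parallel_cube_def T_def)
  also have "\<dots> = (\<integral>\<^sup>+x. emeasure lborel {y. T x + y\<^sup>2 \<le> \<epsilon>\<^sup>2} \<partial>lborel_on D) +
      emeasure (lborel_on D) (parallel_cube D J \<epsilon>)"
    using D by (subst nn_integral_add) simp_all
  also have "(\<integral>\<^sup>+x. emeasure lborel {y. T x + y\<^sup>2 \<le> \<epsilon>\<^sup>2} \<partial>lborel_on D) =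
      emeasure (lborel_on (insert j D)) (parallel_cube (insert j D) J \<epsilon>)"
    using D by (subst slice) (auto intro!: nn_integral_cong simp: smaller)
  finally show ?thesis .
qed

text \<open>
  Unfolding the recursion on the edges, each edge is either kept as a coordinate of a ball or removed
  together with its coordinate; there are \<open>card J choose i\<close> ways to remove \<open>i\<close> of them.
\<close>

lemma emeasure_parallel_cube:
  fixes D J :: "'i set"
  assumes "finite D" "J \<subseteq> D" "0 \<le> \<epsilon>"
  shows "emeasure (lborel_on D) (parallel_cube D J \<epsilon>) =
    ennreal (\<Sum>i\<le>card J. real (card J choose i) *
      (unit_ball_vol (real (card D - i)) * \<epsilon> ^ (card D - i)))"
proof -
  have "finite J" using assms finite_subset by blast
  then show ?thesis
    using assms
  proof (induction J arbitrary: D rule: finite_induct)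
    case empty
    then show ?case by (simp add: emeasure_parallel_cube_empty)
  next
    case (insert j J)
    define E where "E = D - {j}"
    have E: "finite E" "j \<notin> E" "D = insert j E" "J \<subseteq> E" "J \<subseteq> D"
      using insert.prems insert.hyps by (auto simp: E_def)
    define h where "h i = unit_ball_vol (real (card D - i)) * \<epsilon> ^ (card D - i)" for i
    have h_Suc: "h (Suc i) = unit_ball_vol (real (card E - i)) * \<epsilon> ^ (card E - i)" for i
      using E by (simp add: h_def)
    have h_nonneg: "0 \<le> h i" for i
      using \<open>0 \<le> \<epsilon>\<close> by (simp add: h_def)
    have "emeasure (lborel_on D) (parallel_cube D (insert j J) \<epsilon>) =
        emeasure (lborel_on D) (parallel_cube D J \<epsilon>) + emeasure (lborel_on E) (parallel_cube E J \<epsilon>)"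
      using emeasure_parallel_cube_insert[OF E(1,2) insert.hyps(2)] E(3) by simp
    also have "\<dots> = ennreal (\<Sum>i\<le>card J. real (card J choose i) * h i) +
        ennreal (\<Sum>i\<le>card J. real (card J choose i) * h (Suc i))"
      using insert.IH[OF insert.prems(1) E(5) insert.prems(3)] insert.IH[OF E(1) E(4) insert.prems(3)]
      by (simp only: h_Suc) (simp only: h_def)
    also have "\<dots> = ennreal (\<Sum>i\<le>Suc (card J). real (Suc (card J) choose i) * h i)"
      unfolding sum_binomial_Suc by (rule ennreal_plus[symmetric]) (auto intro!: sum_nonneg mult_nonneg_nonneg h_nonneg)
    finally show ?case
      using insert.hyps by (simp add: h_def)
  qed
qed

section \<open>Cubes spanned by orthonormal vectors\<close>

definition orthonormal :: "'a::euclidean_space set \<Rightarrow> bool" where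
  "orthonormal B \<longleftrightarrow> pairwise orthogonal B \<and> (\<forall>b\<in>B. norm b = 1)"

definition orthonormal_cube :: "'a::euclidean_space set \<Rightarrow> 'a set" where
  "orthonormal_cube B = {x \<in> span B. \<forall>b\<in>B. x \<bullet> b \<in> {0..1}}"

text \<open>
  Extend \<open>B\<close> to an orthonormal basis and send the standard basis to it. This reduces statements
  about cubes in arbitrary position to cubes with axis-parallel edges.
\<close>

lemma orthonormal_eq_image_Basis:
  fixes B :: "'a::euclidean_space set"
  assumes "orthonormal B"
  obtains f :: "'a \<Rightarrow> 'a" and J where "orthogonal_transformation f" "J \<subseteq> Basis" "B = f ` J"
proof -
  have orth: "pairwise orthogonal B" and unit: "\<And>b. b \<in> B \<Longrightarrow> norm b = 1"
    using assms by (auto simp: orthonormal_def)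
  obtain U where U: "U \<inter> insert 0 B = {}" "pairwise orthogonal (B \<union> U)" "span (B \<union> U) = span (B \<union> UNIV)"
    using orthogonal_extension_strong[OF orth] .
  define C where "C = B \<union> (\<lambda>u. u /\<^sub>R norm u) ` U"
  have C_eq: "C = (\<lambda>u. u /\<^sub>R norm u) ` (B \<union> U)"
    using unit by (force simp: C_def)
  have nz: "x \<noteq> 0" if "x \<in> B \<union> U" for x
    using U(1) unit that by force
  have C_unit: "norm x = 1" if "x \<in> C" for x
    using that nz by (auto simp: C_eq)
  have C_orth: "pairwise orthogonal C"
  proof (unfold C_eq, rule pairwiseI)
    fix x' y' assume "x' \<in> (\<lambda>u. u /\<^sub>R norm u) ` (B \<union> U)" "y' \<in> (\<lambda>u. u /\<^sub>R norm u) ` (B \<union> U)" "x' \<noteq> y'"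
    then obtain x y where "x \<in> B \<union> U" "y \<in> B \<union> U" "x \<noteq> y"
      and xy: "x' = x /\<^sub>R norm x" "y' = y /\<^sub>R norm y" by blast
    then have "orthogonal x y"
      using pairwiseD[OF U(2)] by blast
    then show "orthogonal x' y'"
      by (simp add: xy orthogonal_def)
  qed
  have C_indep: "independent C"
    using pairwise_orthogonal_independent[OF C_orth] C_unit by force
  have "x \<in> span C" if "x \<in> B \<union> U" for x
  proof -
    have "norm x *\<^sub>R (x /\<^sub>R norm x) \<in> span C"
      using that unfolding C_eq by (intro span_scale span_base) blast
    then show ?thesis using nz[OF that] by simp
  qed
  then have "span (B \<union> U) \<subseteq> span C"
    by (meson span_minimal subsetI subspace_span)
  then have "span C = UNIV"
    using U(3) by auto
  then have card: "card C = DIM('a)"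
    using indep_card_eq_dim_span[OF C_indep] by simp
  have "finite C"
    using C_indep by (rule independent_imp_finite)
  then obtain h :: "'a \<Rightarrow> 'a" where h: "bij_betw h Basis C"
    using card finite_same_card_bij[of "Basis :: 'a set" C] by auto
  define f where "f x = (\<Sum>b\<in>Basis. (x \<bullet> b) *\<^sub>R h b)" for x
  have h_inner: "h b \<bullet> h c = (if b = c then 1 else 0)" if "b \<in> Basis" "c \<in> Basis" for b c
  proof (cases "b = c")
    case True
    have "h b \<in> C" using h that by (auto simp: bij_betw_def)
    with C_unit True show ?thesis by (simp add: dot_square_norm)
  next
    case False
    then have "h b \<noteq> h c" "h b \<in> C" "h c \<in> C"
      using h that by (auto simp: bij_betw_def inj_on_def)
    with C_orth False show ?thesis by (auto simp: pairwise_def orthogonal_def)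
  qed
  have "orthogonal_transformation f"
    unfolding orthogonal_transformation_def
  proof (intro conjI allI)
    show "linear f"
      unfolding f_def by (intro linearI) (simp_all add: inner_add_left scaleR_add_left sum.distrib scaleR_sum_right)
    show "f v \<bullet> f w = v \<bullet> w" for v w
    proof -
      have "f v \<bullet> f w = (\<Sum>b\<in>Basis. \<Sum>c\<in>Basis. (v \<bullet> b) * ((w \<bullet> c) * (h b \<bullet> h c)))"
        by (simp add: f_def inner_sum_left inner_sum_right sum_distrib_left mult_ac) (rule sum.swap)
      also have "\<dots> = (\<Sum>b\<in>Basis. \<Sum>c\<in>Basis. if b = c then (v \<bullet> b) * (w \<bullet> c) else 0)"
        by (intro sum.cong refl) (simp add: h_inner)
      also have "\<dots> = v \<bullet> w"
        by (simp add: sum.delta euclidean_inner[of v w])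
      finally show ?thesis .
    qed
  qed
  moreover have f_Basis: "f b = h b" if "b \<in> Basis" for b
  proof -
    have "f b = (\<Sum>c\<in>Basis. if b = c then h c else 0)"
      unfolding f_def using that by (intro sum.cong refl) (simp add: inner_Basis)
    then show ?thesis using that by simp
  qed
  have "f ` Basis = C"
    using h f_Basis by (simp add: bij_betw_def)
  then have "B \<subseteq> f ` Basis"
    by (simp add: C_def)
  then obtain J where "J \<subseteq> Basis" "B = f ` J"
    using subset_imageE by metis
  ultimately show ?thesis using that by blast
qed

lemma orthonormal_cube_image:
  assumes f: "orthogonal_transformation f"
  shows "orthonormal_cube (f ` J) = f ` orthonormal_cube J"
proof -
  have "span (f ` J) = f ` span J"
    using orthogonal_transformation_linear[OF f] by (rule linear_span_image)
  moreover have "f x \<bullet> f y = x \<bullet> y" for x y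
    using f by (simp add: orthogonal_transformation_def)
  ultimately show ?thesis
    by (auto simp: orthonormal_cube_def)
qed

lemma orthonormal_cube_Basis:
  assumes "J \<subseteq> Basis"
  shows "orthonormal_cube J = {x. \<forall>b\<in>Basis. x \<bullet> b \<in> (if b \<in> J then {0..1} else {0})}"
  using assms by (auto simp: orthonormal_cube_def span_substd_basis split: if_splits)

lemma compact_orthonormal_cube:
  assumes "orthonormal B"
  shows "compact (orthonormal_cube B)"
proof -
  obtain f :: "'a \<Rightarrow> 'a" and J where f: "orthogonal_transformation f" and J: "J \<subseteq> Basis" and B: "B = f ` J"
    using orthonormal_eq_image_Basis[OF assms] .
  have "orthonormal_cube J = cbox 0 (\<Sum>b\<in>J. b)"
  proof -
    have "(\<Sum>c\<in>J. c) \<bullet> b = (if b \<in> J then 1 else 0)" if "b \<in> Basis" for b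
    proof -
      have "(\<Sum>c\<in>J. c) \<bullet> b = (\<Sum>c\<in>J. if b = c then 1 else 0)"
        unfolding inner_sum_left using J that by (intro sum.cong refl) (auto simp: inner_Basis)
      then show ?thesis
        using finite_subset[OF J finite_Basis] by simp
    qed
    then show ?thesis
      unfolding orthonormal_cube_Basis[OF J] by (auto simp: mem_box split: if_splits)
  qed
  then have "compact (orthonormal_cube J)" by simp
  then have "compact (f ` orthonormal_cube J)"
    using orthogonal_transformation_linear[OF f]
    by (intro compact_continuous_image linear_continuous_on) (auto simp: linear_conv_bounded_linear)
  then show ?thesis
    by (simp add: B orthonormal_cube_image[OF f])
qed

lemma convex_orthonormal_cube: "convex (orthonormal_cube B)"
proof -
  have "orthonormal_cube B = span B \<inter> (\<Inter>b\<in>B. {x. b \<bullet> x \<ge> 0} \<inter> {x. b \<bullet> x \<le> 1})"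
    by (auto simp: orthonormal_cube_def inner_commute)
  moreover have "convex (span B)"
    by (simp add: subspace_imp_convex)
  ultimately show ?thesis
    by (simp add: convex_Int convex_INT convex_halfspace_ge convex_halfspace_le)
qed

lemma zero_in_orthonormal_cube: "0 \<in> orthonormal_cube B"
  by (simp add: orthonormal_cube_def span_zero)

lemma compact_set_plus:
  fixes S T :: "'a::real_normed_vector set"
  assumes "compact S" "compact T"
  shows "compact (S + T)"
proof -
  have "S + T = {x + y | x y. x \<in> S \<and> y \<in> T}"
    by (auto simp: set_plus_def)
  then show ?thesis
    using compact_sums[OF assms] by simp
qed

text \<open>
  A point in the Minkowski sum has coordinatewise overshoot at most the corresponding coordinate of the
  ball vector; conversely, clamping the coordinates of a point gives its nearest point in the cube.
\<close>

lemma orthonormal_cube_Basis_plus_cball: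
  fixes J :: "'a::euclidean_space set"
  assumes J: "J \<subseteq> Basis" and "0 \<le> \<epsilon>"
  shows "orthonormal_cube J + cball 0 \<epsilon> =
    {x. (\<Sum>b\<in>Basis. (if b \<in> J then overshoot (x \<bullet> b) else x \<bullet> b)\<^sup>2) \<le> \<epsilon>\<^sup>2}" (is "_ = ?R")
proof (intro equalityI subsetI)
  fix x assume "x \<in> orthonormal_cube J + cball 0 \<epsilon>"
  then obtain q u where q: "q \<in> orthonormal_cube J" and u: "norm u \<le> \<epsilon>" and x: "x = q + u"
    by (auto elim!: set_plus_elim)
  have "(\<Sum>b\<in>Basis. (if b \<in> J then overshoot (x \<bullet> b) else x \<bullet> b)\<^sup>2) \<le> (\<Sum>b\<in>Basis. (u \<bullet> b)\<^sup>2)"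
  proof (rule sum_mono)
    fix b :: 'a assume "b \<in> Basis"
    then have "q \<bullet> b \<in> (if b \<in> J then {0..1} else {0})"
      using q unfolding orthonormal_cube_Basis[OF J] by blast
    then have "\<bar>if b \<in> J then overshoot (x \<bullet> b) else x \<bullet> b\<bar> \<le> \<bar>u \<bullet> b\<bar>"
      using abs_overshoot_le[of "q \<bullet> b" "x \<bullet> b"] by (auto simp: x inner_add_left split: if_splits)
    then show "(if b \<in> J then overshoot (x \<bullet> b) else x \<bullet> b)\<^sup>2 \<le> (u \<bullet> b)\<^sup>2"
      by (simp only: abs_le_square_iff)
  qed
  also have "\<dots> = (norm u)\<^sup>2"
    unfolding power2_norm_eq_inner euclidean_inner[of u u] by (simp add: power2_eq_square)
  also have "\<dots> \<le> \<epsilon>\<^sup>2"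
    using u by (simp add: power_mono)
  finally show "x \<in> ?R" by simp
next
  fix x assume x: "x \<in> ?R"
  define q where "q = (\<Sum>b\<in>Basis. (if b \<in> J then max 0 (min 1 (x \<bullet> b)) else 0) *\<^sub>R b)"
  have q_inner: "q \<bullet> b = (if b \<in> J then max 0 (min 1 (x \<bullet> b)) else 0)" if "b \<in> Basis" for b
    using that by (simp add: q_def)
  have q: "q \<in> orthonormal_cube J"
    unfolding orthonormal_cube_Basis[OF J] by (auto simp: q_inner)
  have "(norm (x - q))\<^sup>2 = (\<Sum>b\<in>Basis. (if b \<in> J then overshoot (x \<bullet> b) else x \<bullet> b)\<^sup>2)"
    unfolding power2_norm_eq_inner euclidean_inner[of "x - q" "x - q"]
    by (intro sum.cong refl) (simp add: inner_diff_left q_inner overshoot_def power2_eq_square)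
  then have "norm (x - q) \<le> \<epsilon>"
    using x \<open>0 \<le> \<epsilon>\<close> by (simp add: power2_le_imp_le[of "norm (x - q)" \<epsilon>])
  then have "q + (x - q) \<in> orthonormal_cube J + cball 0 \<epsilon>"
    using q by (intro set_plus_intro) auto
  then show "x \<in> orthonormal_cube J + cball 0 \<epsilon>" by simp
qed

lemma emeasure_orthonormal_cube_plus_cball:
  fixes B :: "'a::euclidean_space set"
  assumes "orthonormal B" and "0 \<le> \<epsilon>"
  shows "emeasure lborel (orthonormal_cube B + cball 0 \<epsilon>) =
    ennreal (\<Sum>i\<le>card B. real (card B choose i) *
      (unit_ball_vol (real (DIM('a) - i)) * \<epsilon> ^ (DIM('a) - i)))"
proof -
  obtain f :: "'a \<Rightarrow> 'a" and J where f: "orthogonal_transformation f" and J: "J \<subseteq> Basis" and B: "B = f ` J"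
    using orthonormal_eq_image_Basis[OF assms(1)] .
  have card: "card B = card J"
    unfolding B by (meson card_image inj_on_subset orthogonal_transformation_inj[OF f] subset_UNIV)
  have lin: "linear f" using f by (rule orthogonal_transformation_linear)
  have J': "orthonormal J"
    using J by (auto simp: orthonormal_def pairwise_def orthogonal_def inner_not_same_Basis subset_iff)
  have "orthonormal_cube B + cball 0 \<epsilon> = f ` orthonormal_cube J + f ` cball 0 \<epsilon>"
    by (simp add: B orthonormal_cube_image[OF f] image_orthogonal_transformation_cball[OF f] linear_0[OF lin])
  also have "\<dots> = f ` (orthonormal_cube J + cball 0 \<epsilon>)"
    by (force simp: set_plus_def linear_add[OF lin])
  also have "emeasure lborel \<dots> = emeasure lborel (orthonormal_cube J + cball 0 \<epsilon>)"
    by (intro emeasure_lborel_orthogonal_image[OF f] compact_set_plus compact_orthonormal_cube[OF J'] compact_cball)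
  also have "\<dots> = emeasure (lborel_on Basis) (parallel_cube Basis J \<epsilon>)"
    unfolding orthonormal_cube_Basis_plus_cball[OF J assms(2)]
  proof (subst lborel_eq, subst emeasure_distr)
    have "(\<Sum>b\<in>Basis. (if b \<in> J then overshoot ((\<Sum>c\<in>Basis. x c *\<^sub>R c) \<bullet> b)
            else (\<Sum>c\<in>Basis. x c *\<^sub>R c) \<bullet> b)\<^sup>2) =
        (\<Sum>b\<in>Basis. (if b \<in> J then overshoot (x b) else x b)\<^sup>2)" for x :: "'a \<Rightarrow> real"
      by (intro sum.cong refl) simp
    then show "emeasure (lborel_on Basis) ((\<lambda>f. \<Sum>b\<in>Basis. f b *\<^sub>R b) -`
        {x. (\<Sum>b\<in>Basis. (if b \<in> J then overshoot (x \<bullet> b) else x \<bullet> b)\<^sup>2) \<le> \<epsilon>\<^sup>2} \<inter>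
        space (lborel_on Basis)) = emeasure (lborel_on Basis) (parallel_cube Basis J \<epsilon>)"
      by (intro arg_cong[where f = "emeasure _"]) (auto simp: parallel_cube_def)
  qed simp_all
  also have "\<dots> = ennreal (\<Sum>i\<le>card J. real (card J choose i) *
      (unit_ball_vol (real (DIM('a) - i)) * \<epsilon> ^ (DIM('a) - i)))"
    by (rule emeasure_parallel_cube[OF finite_Basis J assms(2)])
  finally show ?thesis by (simp only: card)
qed

section \<open>Intrinsic volumes of cubes\<close>

lemma polynomial_coeffs_eq:
  fixes a b :: "nat \<Rightarrow> real"
  assumes "\<And>x. 0 \<le> x \<Longrightarrow> (\<Sum>i\<le>n. a i * x ^ i) = (\<Sum>i\<le>n. b i * x ^ i)" and "i \<le> n"
  shows "a i = b i"
proof (rule ccontr)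
  assume "a i \<noteq> b i"
  then have "finite {x. (\<Sum>i\<le>n. (a i - b i) * x ^ i) = 0}"
    using \<open>i \<le> n\<close> unfolding polyfun_finite_roots by auto
  moreover have "{0::real..} \<subseteq> {x. (\<Sum>i\<le>n. (a i - b i) * x ^ i) = 0}"
    using assms(1) by (auto simp: left_diff_distrib sum_subtractf)
  ultimately show False
    using infinite_Ici[of "0::real"] finite_subset by blast
qed

text \<open>
  Steiner's formula determines its coefficients, because a polynomial is determined by its values on
  the nonnegative reals and the volumes of the unit balls do not vanish. So any sequence satisfying
  the formula is the sequence of intrinsic volumes.
\<close>

lemma intrinsic_volumes_eqI:
  fixes K :: "(real ^ 'n) set" and W :: "nat \<Rightarrow> real"
  assumes zero: "\<And>i. i > CARD('n) \<Longrightarrow> W i = 0"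
    and steiner: "\<And>\<epsilon>. 0 \<le> \<epsilon> \<Longrightarrow> measure lebesgue (K + cball 0 \<epsilon>) =
      (\<Sum>i\<le>CARD('n). \<epsilon> ^ (CARD('n) - i) * unit_ball_vol (real (CARD('n) - i)) * W i)"
  shows "intrinsic_volumes K = W"
  unfolding intrinsic_volumes_def
proof (rule the_equality)
  have ball: "(\<lambda>x. \<epsilon> *\<^sub>R x) ` cball 0 1 = cball (0 :: real ^ 'n) \<epsilon>" if "0 \<le> \<epsilon>" for \<epsilon>
  proof (cases "\<epsilon> = 0")
    case True
    then show ?thesis by (auto simp: image_constant_conv)
  next
    case False
    then show ?thesis using that cball_scale[of \<epsilon> 0 1] by simp
  qed
  then show W: "(\<forall>i>CARD('n). W i = 0) \<and>
      (\<forall>\<epsilon>\<ge>0. measure lebesgue (K + (*\<^sub>R) \<epsilon> ` cball 0 1) =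
        (\<Sum>i\<le>CARD('n). \<epsilon> ^ (CARD('n) - i) * unit_ball_vol (real (CARD('n) - i)) * W i))"
    using zero steiner by simp
  fix V :: "nat \<Rightarrow> real"
  assume V: "(\<forall>i>CARD('n). V i = 0) \<and>
      (\<forall>\<epsilon>\<ge>0. measure lebesgue (K + (*\<^sub>R) \<epsilon> ` cball 0 1) =
        (\<Sum>i\<le>CARD('n). \<epsilon> ^ (CARD('n) - i) * unit_ball_vol (real (CARD('n) - i)) * V i))"
  let ?coeff = "\<lambda>U j. unit_ball_vol (real j) * U (CARD('n) - j)"
  have rev: "(\<Sum>i\<le>CARD('n). \<epsilon> ^ (CARD('n) - i) * unit_ball_vol (real (CARD('n) - i)) * U i) =
      (\<Sum>j\<le>CARD('n). ?coeff U j * \<epsilon> ^ j)" for \<epsilon> and U :: "nat \<Rightarrow> real"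
    by (rule sum.reindex_bij_witness[where i = "\<lambda>j. CARD('n) - j" and j = "\<lambda>j. CARD('n) - j"]) auto
  have coeff: "?coeff V j = ?coeff W j" if "j \<le> CARD('n)" for j
  proof (rule polynomial_coeffs_eq[OF _ that])
    fix x :: real assume "0 \<le> x"
    then show "(\<Sum>j\<le>CARD('n). ?coeff V j * x ^ j) = (\<Sum>j\<le>CARD('n). ?coeff W j * x ^ j)"
      using V W unfolding rev[symmetric] by simp
  qed
  show "V = W"
  proof
    fix i
    show "V i = W i"
    proof (cases "i \<le> CARD('n)")
      case True
      then show ?thesis
        using coeff[of "CARD('n) - i"] unit_ball_vol_pos[of "real (CARD('n) - i)"]
        by (auto simp del: unit_ball_vol_pos)
    next
      case False
      then show ?thesis using V zero by simp
    qed
  qed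
qed

lemma card_orthonormal_le:
  fixes B :: "'a::euclidean_space set"
  assumes "orthonormal B"
  shows "card B \<le> DIM('a)"
proof -
  have "independent B"
    using assms by (intro pairwise_orthogonal_independent) (auto simp: orthonormal_def)
  then show ?thesis
    by (simp add: independent_bound)
qed

lemma intrinsic_volumes_orthonormal_cube:
  fixes B :: "(real ^ 'n) set"
  assumes B: "orthonormal B"
  shows "intrinsic_volumes (orthonormal_cube B) = (\<lambda>i. real (card B choose i))"
proof (rule intrinsic_volumes_eqI)
  have card: "card B \<le> CARD('n)"
    using card_orthonormal_le[OF B] by simp
  then show "real (card B choose i) = 0" if "i > CARD('n)" for i
    using that by simp
  fix \<epsilon> :: real assume "0 \<le> \<epsilon>"
  let ?S = "\<Sum>i\<le>card B. real (card B choose i) *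
      (unit_ball_vol (real (CARD('n) - i)) * \<epsilon> ^ (CARD('n) - i))"
  have "compact (orthonormal_cube B + cball 0 \<epsilon>)"
    by (intro compact_set_plus compact_orthonormal_cube[OF B] compact_cball)
  then have "measure lebesgue (orthonormal_cube B + cball 0 \<epsilon>) = measure lborel (orthonormal_cube B + cball 0 \<epsilon>)"
    by (simp add: measure_completion borel_compact)
  also have "\<dots> = ?S"
    unfolding measure_def emeasure_orthonormal_cube_plus_cball[OF B \<open>0 \<le> \<epsilon>\<close>]
    using \<open>0 \<le> \<epsilon>\<close> by (simp add: sum_nonneg)
  also have "\<dots> = (\<Sum>i\<le>CARD('n). \<epsilon> ^ (CARD('n) - i) * unit_ball_vol (real (CARD('n) - i)) * real (card B choose i))"
    using card by (intro sum.mono_neutral_cong_left) auto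
  finally show "measure lebesgue (orthonormal_cube B + cball 0 \<epsilon>) = \<dots>" .
qed

lemma intrinsic_volumes_translation:
  "intrinsic_volumes ((+) a ` K) = intrinsic_volumes K"
proof -
  have "(+) a ` K + X = (+) a ` (K + X)" for X
  proof -
    have "(+) a ` K + X = {(a + k) + y | k y. k \<in> K \<and> y \<in> X}"
      by (auto simp: set_plus_def)
    also have "\<dots> = (+) a ` (K + X)"
      by (auto simp: set_plus_def add.assoc)
    finally show ?thesis .
  qed
  then show ?thesis
    unfolding intrinsic_volumes_def by (simp add: measure_translation)
qed

section \<open>Generic vectors lie in almost no subspace\<close>

text \<open>
  The next lemmas identify \<open>closest_point L\<close> with the orthogonal projection onto \<open>L\<close>. Its linearity
  is what makes the matrix in the definition of the sigma-algebra on subspaces meaningful.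
\<close>

lemma closest_point_subspace_eqI:
  fixes L :: "'a::euclidean_space set"
  assumes L: "subspace L" and y: "y \<in> L" and orth: "\<And>w. w \<in> L \<Longrightarrow> orthogonal (x - y) w"
  shows "closest_point L x = y"
proof (rule closest_point_unique[symmetric])
  show "convex L" "closed L" using L by (auto simp: subspace_imp_convex closed_subspace)
  show "\<forall>z\<in>L. dist x y \<le> dist x z"
  proof
    fix z assume "z \<in> L"
    then have "orthogonal (x - y) (y - z)"
      using L y by (intro orth) (simp add: subspace_diff)
    then have "(norm (x - y + (y - z)))\<^sup>2 = (norm (x - y))\<^sup>2 + (norm (y - z))\<^sup>2"
      by (rule norm_add_Pythagorean)
    then have "(norm (x - y))\<^sup>2 \<le> (norm (x - z))\<^sup>2"
      by simp
    then have "norm (x - y) \<le> norm (x - z)"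
      by (rule power2_le_imp_le) simp
    then show "dist x y \<le> dist x z"
      by (simp add: dist_norm)
  qed
qed (fact y)

lemma linear_closest_point_subspace:
  fixes L :: "'a::euclidean_space set"
  assumes L: "subspace L"
  shows "linear (closest_point L)"
proof -
  have span: "span L = L" using L by (simp add: span_eq_iff)
  have proj: "closest_point L x \<in> L" "\<And>w. w \<in> L \<Longrightarrow> orthogonal (x - closest_point L x) w" for x
  proof -
    obtain y z where yz: "y \<in> span L" "\<And>w. w \<in> span L \<Longrightarrow> orthogonal z w" "x = y + z"
      using orthogonal_subspace_decomp_exists[of L x] by metis
    then have "closest_point L x = y"
      using L by (intro closest_point_subspace_eqI) (auto simp: span)
    with yz show "closest_point L x \<in> L" "\<And>w. w \<in> L \<Longrightarrow> orthogonal (x - closest_point L x) w"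
      by (auto simp: span)
  qed
  show ?thesis
  proof (rule linearI)
    fix x y :: 'a and c :: real
    have "orthogonal (x + y - (closest_point L x + closest_point L y)) w" if "w \<in> L" for w
      using proj(2)[OF that, of x] proj(2)[OF that, of y]
      by (simp add: orthogonal_def inner_diff_left inner_add_left)
    then show "closest_point L (x + y) = closest_point L x + closest_point L y"
      using L proj(1) by (intro closest_point_subspace_eqI) (auto simp: subspace_add)
    have "orthogonal (c *\<^sub>R x - c *\<^sub>R closest_point L x) w" if "w \<in> L" for w
      using proj(2)[OF that, of x] by (simp add: orthogonal_def inner_diff_left)
    then show "closest_point L (c *\<^sub>R x) = c *\<^sub>R closest_point L x"
      using L proj(1) by (intro closest_point_subspace_eqI) (auto simp: subspace_scale)
  qed
qed

text \<open>
  This describes membership in \<open>L\<close> by the only quantity that is measurable in \<open>L\<close> by definition, the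
  projection matrix; both sides of the equation depend continuously on that matrix and \<open>x\<close>.
\<close>

lemma mem_subspace_iff_projection_matrix:
  fixes L :: "(real ^ 'n) set"
  assumes L: "subspace L"
  shows "x \<in> L \<longleftrightarrow> matrix (closest_point L) *v x = x"
proof -
  have "closed L" "L \<noteq> {}"
    using closed_subspace[OF L] subspace_0[OF L] by auto
  then have "x \<in> L \<longleftrightarrow> closest_point L x = x"
    by (metis closest_point_in_set closest_point_self)
  also have "closest_point L x = matrix (closest_point L) *v x"
    using linear_closest_point_subspace[OF L] by (simp add: matrix_vector_mul(2))
  finally show ?thesis .
qed

lemma null_sets_lborel_subspace:
  fixes L :: "'a::euclidean_space set"
  assumes "subspace L" "dim L < DIM('a)"
  shows "L \<in> null_sets lborel"
proof -
  have "L \<in> null_sets lebesgue"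
    using negligible_lowdim[OF assms(2)] by (simp add: negligible_iff_null_sets)
  moreover have "L \<in> sets lborel"
    using assms(1) by (simp add: closed_subspace borel_closed)
  ultimately show ?thesis
    by (simp add: null_sets_completion_iff)
qed

text \<open>
  Fubini's theorem: every \<open>L\<close> is a null set, hence the set of pairs \<open>(x, L)\<close> with \<open>x \<in> L\<close> is null for
  the product measure.
\<close>

lemma AE_lborel_AE_not_mem:
  fixes \<nu> :: "(real ^ 'n) set measure"
  assumes prob: "prob_space \<nu>"
    and space: "space \<nu> = subspaces_containing L0 k"
    and sets: "sets \<nu> = sets (borel_subspaces_containing L0 k)"
    and k: "k < CARD('n)"
  shows "AE x in lborel. AE L in \<nu>. x \<notin> L"
proof -
  interpret prob_space \<nu> by fact
  interpret P: pair_sigma_finite lborel \<nu> by standard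
  have sub: "subspace L" "dim L = k" if "L \<in> space \<nu>" for L
    using that by (auto simp: space subspaces_containing_def grassmannian_def)
  have proj [measurable]: "(\<lambda>L. matrix (closest_point L)) \<in> borel_measurable \<nu>"
    unfolding measurable_cong_sets[OF sets refl] borel_subspaces_containing_def
    by (rule measurable_vimage_algebra1) simp
  have cont: "continuous_on UNIV (\<lambda>p. fst p *v snd p :: real ^ 'n)"
    unfolding matrix_vector_mult_def
    by (intro continuous_on_vec_lambda continuous_intros)
  have [measurable]: "(\<lambda>p. matrix (closest_point (snd p)) *v fst p) \<in> borel_measurable (lborel \<Otimes>\<^sub>M \<nu>)"
    by (rule borel_measurable_continuous_Pair[OF _ _ cont]) measurable
  have "{p \<in> space (lborel \<Otimes>\<^sub>M \<nu>). fst p \<notin> snd p} =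
      {p \<in> space (lborel \<Otimes>\<^sub>M \<nu>). matrix (closest_point (snd p)) *v fst p \<noteq> fst p}"
    using mem_subspace_iff_projection_matrix[OF sub(1)] by (auto simp: space_pair_measure)
  also have "\<dots> \<in> sets (lborel \<Otimes>\<^sub>M \<nu>)"
    by measurable
  finally have "(AE x in lborel. AE L in \<nu>. x \<notin> L) \<longleftrightarrow> (AE L in \<nu>. AE x in lborel. x \<notin> L)"
    by (rule P.AE_commute)
  moreover have "AE x in lborel. x \<notin> L" if "L \<in> space \<nu>" for L
    using sub[OF that] k by (intro AE_not_in null_sets_lborel_subspace) auto
  ultimately show ?thesis
    by (simp add: AE_I2)
qed

text \<open>
  A generic point may be replaced by its normalized component orthogonal to \<open>L0\<close>: since \<open>L0 \<subseteq> L\<close>,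
  the two lie in the same subspaces \<open>L\<close>.
\<close>

lemma ex_unit_normal_AE_not_mem:
  fixes \<nu> :: "(real ^ 'n) set measure"
  assumes prob: "prob_space \<nu>"
    and space: "space \<nu> = subspaces_containing L0 k"
    and sets: "sets \<nu> = sets (borel_subspaces_containing L0 k)"
    and k: "k < CARD('n)" and L0: "subspace L0" "dim L0 < CARD('n)"
  obtains g where "norm g = 1" "\<And>w. w \<in> L0 \<Longrightarrow> orthogonal g w" "AE L in \<nu>. g \<notin> L"
proof -
  have "AE x in lborel. x \<notin> L0"
    using L0 by (intro AE_not_in null_sets_lborel_subspace) auto
  with AE_lborel_AE_not_mem[OF prob space sets k]
  have "AE x in lborel. x \<notin> L0 \<and> (AE L in \<nu>. x \<notin> L)"
    by eventually_elim simp
  moreover have "ae_filter (lborel :: (real ^ 'n) measure) \<noteq> bot"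
    by (simp add: ae_filter_eq_bot_iff)
  ultimately obtain x where x: "x \<notin> L0" "AE L in \<nu>. x \<notin> L"
    using eventually_happens' by blast
  obtain y z where yz: "y \<in> L0" "\<And>w. w \<in> L0 \<Longrightarrow> orthogonal z w" "x = y + z"
    using orthogonal_subspace_decomp_exists[of L0 x] L0(1) by (metis span_eq_iff)
  have "z \<noteq> 0" using x yz by auto
  show ?thesis
  proof
    show "norm (z /\<^sub>R norm z) = 1" using \<open>z \<noteq> 0\<close> by simp
    show "orthogonal (z /\<^sub>R norm z) w" if "w \<in> L0" for w
      using yz(2)[OF that] by (simp add: orthogonal_def)
    show "AE L in \<nu>. z /\<^sub>R norm z \<notin> L"
      using x(2)
    proof (rule AE_mp, intro AE_I2 impI notI)
      fix L assume "L \<in> space \<nu>" "x \<notin> L" "z /\<^sub>R norm z \<in> L"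
      then have "subspace L" "L0 \<subseteq> L"
        by (auto simp: space subspaces_containing_def grassmannian_def)
      then have "norm z *\<^sub>R (z /\<^sub>R norm z) \<in> L" "y \<in> L"
        using \<open>z /\<^sub>R norm z \<in> L\<close> yz(1) by (auto intro: subspace_scale simp del: scaleR_scaleR)
      then have "x \<in> L"
        using \<open>subspace L\<close> \<open>z \<noteq> 0\<close> yz(3) by (simp add: subspace_add)
      with \<open>x \<notin> L\<close> show False by simp
    qed
  qed
qed

section \<open>Almost sure sections of cubes\<close>

text \<open>
  In a point of the section, the component along \<open>g\<close> is a difference of elements of \<open>L\<close>, hence a
  multiple of \<open>g\<close> in \<open>L\<close>, hence zero. What remains is the face of the cube at \<open>0\<close> orthogonal to \<open>g\<close>.
\<close>

lemma orthonormal_cube_insert_Int_subspace: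
  assumes ortho: "orthonormal (insert g B)" and L: "subspace L" "B \<subseteq> L" "g \<notin> L"
  shows "orthonormal_cube (insert g B) \<inter> L = orthonormal_cube B"
proof -
  have g: "g \<bullet> g = 1" and g_B: "\<And>b. b \<in> B \<Longrightarrow> orthogonal g b"
    using ortho L by (auto simp: orthonormal_def pairwise_insert dot_square_norm)
  have g_span: "q \<bullet> g = 0" if "q \<in> span B" for q
    using orthogonal_to_span[OF that g_B] by (simp add: orthogonal_def inner_commute)
  have span_L: "span B \<subseteq> L"
    using L by (simp add: span_minimal)
  have "x \<in> span B" if x: "x \<in> span (insert g B)" "x \<in> L" for x
  proof -
    obtain c where c: "x - c *\<^sub>R g \<in> span B"
      using x(1) unfolding span_breakdown_eq ..
    then have "x - (x - c *\<^sub>R g) \<in> L"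
      using span_L x(2) L(1) by (blast intro: subspace_diff)
    then have "c *\<^sub>R g \<in> L" by simp
    then have "c = 0"
      using subspace_scale[OF L(1), of "c *\<^sub>R g" "inverse c"] L(3) by (cases "c = 0") auto
    with c show ?thesis by simp
  qed
  moreover have "span B \<subseteq> span (insert g B)"
    by (intro span_mono) blast
  ultimately show ?thesis
    using span_L g_span by (auto simp: orthonormal_cube_def)
qed

lemma orthonormal_cube_in_convex_bodies: "orthonormal B \<Longrightarrow> orthonormal_cube B \<in> convex_bodies"
  using compact_orthonormal_cube[of B] convex_orthonormal_cube[of B] zero_in_orthonormal_cube[of B]
  by (auto simp: convex_bodies_def)

lemma intrinsic_volume_0_singleton: "intrinsic_volume 0 {a :: real ^ 'n} = 1"
proof -
  have "{a} = (+) a ` orthonormal_cube {}"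
    by (auto simp: orthonormal_cube_def)
  then show ?thesis
    by (simp add: intrinsic_volumes_translation intrinsic_volumes_orthonormal_cube orthonormal_def)
qed

theorem proposition6:
  fixes r k m :: nat
    and L0 :: "(real ^ 'n) set"
    and \<nu> :: "(real ^ 'n) set measure"
  assumes "CARD('n) \<ge> 3"
    and "r + 1 \<le> k" and "k \<le> CARD('n) - 1"
    and "L0 \<in> grassmannian r"
    and "m \<in> {0..r + 1}"
    and "invariant_prob L0 k \<nu>"
  shows "\<not> (\<exists>\<phi> :: (real ^ 'n) set \<Rightarrow> real.
            (m = 0 \<longrightarrow> \<phi> {} = 0) \<and>
            (\<forall>K\<in>convex_bodies.
               integrable \<nu> (\<lambda>L. \<phi> (K \<inter> L)) \<and>
               (LINT L|\<nu>. \<phi> (K \<inter> L)) = intrinsic_volume m K))"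
proof (rule notI, elim exE conjE)
  fix \<phi> :: "(real ^ 'n) set \<Rightarrow> real"
  assume empty: "m = 0 \<longrightarrow> \<phi> {} = 0"
    and rep: "\<forall>K\<in>convex_bodies. integrable \<nu> (\<lambda>L. \<phi> (K \<inter> L)) \<and>
      (LINT L|\<nu>. \<phi> (K \<inter> L)) = intrinsic_volume m K"
  have L0: "subspace L0" "dim L0 = r"
    using assms(4) by (auto simp: grassmannian_def)
  have \<nu>: "prob_space \<nu>" "space \<nu> = subspaces_containing L0 k"
    "sets \<nu> = sets (borel_subspaces_containing L0 k)"
    using assms(6) by (auto simp: invariant_prob_def)
  interpret prob_space \<nu> by fact
  have sub: "subspace L" "L0 \<subseteq> L" if "L \<in> space \<nu>" for L
    using that by (auto simp: \<nu> subspaces_containing_def grassmannian_def)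
  obtain g where g: "norm g = 1" "\<And>w. w \<in> L0 \<Longrightarrow> orthogonal g w" "AE L in \<nu>. g \<notin> L"
  proof (rule ex_unit_normal_AE_not_mem[OF \<nu>])
    show "k < CARD('n)" "dim L0 < CARD('n)"
      using assms(1-3) L0(2) by auto
  qed (use L0 in auto)
  have const: "\<phi> C = intrinsic_volume m K"
    if K: "K \<in> convex_bodies" and C: "AE L in \<nu>. K \<inter> L = C" for K C
  proof -
    have "(LINT L|\<nu>. \<phi> (K \<inter> L)) = (LINT L|\<nu>. \<phi> C)"
    proof (rule integral_cong_AE)
      show "(\<lambda>L. \<phi> (K \<inter> L)) \<in> borel_measurable \<nu>"
        using rep K by blast
      show "AE L in \<nu>. \<phi> (K \<inter> L) = \<phi> C"
        using C by eventually_elim simp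
    qed simp
    then show ?thesis
      using rep K by (simp add: prob_space)
  qed
  show False
  proof (cases m)
    case 0
    have "AE L in \<nu>. {g} \<inter> L = {}"
      using g(3) by eventually_elim simp
    then have "\<phi> {} = intrinsic_volume m {g}"
      by (intro const) (simp_all add: convex_bodies_def)
    then show False
      using empty by (simp add: 0 intrinsic_volume_0_singleton)
  next
    case (Suc j)
    obtain B0 where B0: "B0 \<subseteq> L0" "pairwise orthogonal B0" "\<And>x. x \<in> B0 \<Longrightarrow> norm x = 1" "card B0 = dim L0"
      using orthonormal_basis_subspace[OF L0(1)] by metis
    have "j \<le> card B0"
      using assms(5) Suc B0(4) L0(2) by simp
    then obtain B where B: "B \<subseteq> B0" "card B = j" "finite B"
      using obtain_subset_with_card_n by metis
    have B_ortho: "orthonormal B"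
      using B B0 by (auto simp: orthonormal_def pairwise_subset)
    have B_L0: "B \<subseteq> L0" using B B0 by blast
    have gB_ortho: "orthonormal (insert g B)"
      using B_ortho g B_L0 by (auto simp: orthonormal_def pairwise_insert orthogonal_commute)
    have "g \<notin> B"
      using g(1,2) B_L0 by (force simp: orthogonal_self)
    have "AE L in \<nu>. orthonormal_cube B \<inter> L = orthonormal_cube B"
    proof (rule AE_I2)
      fix L assume "L \<in> space \<nu>"
      then have "span B \<subseteq> L"
        using sub B_L0 by (intro span_minimal) auto
      then show "orthonormal_cube B \<inter> L = orthonormal_cube B"
        by (auto simp: orthonormal_cube_def)
    qed
    then have "\<phi> (orthonormal_cube B) = intrinsic_volume m (orthonormal_cube B)"
      by (rule const[OF orthonormal_cube_in_convex_bodies[OF B_ortho]])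
    moreover have "AE L in \<nu>. orthonormal_cube (insert g B) \<inter> L = orthonormal_cube B"
      using g(3)
    proof (rule AE_mp, intro AE_I2 impI)
      fix L assume "L \<in> space \<nu>" "g \<notin> L"
      then show "orthonormal_cube (insert g B) \<inter> L = orthonormal_cube B"
        using sub B_L0 by (intro orthonormal_cube_insert_Int_subspace[OF gB_ortho]) auto
    qed
    then have "\<phi> (orthonormal_cube B) = intrinsic_volume m (orthonormal_cube (insert g B))"
      by (rule const[OF orthonormal_cube_in_convex_bodies[OF gB_ortho]])
    ultimately show False
      using B(2,3) \<open>g \<notin> B\<close> Suc
      by (simp add: intrinsic_volumes_orthonormal_cube B_ortho gB_ortho binomial_eq_0)
  qed
qed

end
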